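(* Let $f,g:\mathbb{R}^{d_x}\times\mathbb{R}^{d_y}\to\mathbb{R}$ and let $\mu,\bar\sigma,l_f,L_f,L_g,\rho_f,\rho_g>0$ be constants such that: (1) for every $0\le\sigma\le\bar\sigma$ and every $x$, the function $y\mapsto \sigma f(x,y)+g(x,y)$ is $\mu$-PŁ; (2) $f$ is $l_f$-Lipschitz with $L_f$-Lipschitz gradient; (3) $g$ has $L_g$-Lipschitz gradient; (4) $f$ has $\rho_f$-Lipschitz Hessian; (5) $g$ has $\rho_g$-Lipschitz Hessian. Run the algorithm A$^2$F$^2$BA described in the context with tolerance $\epsilon>0$ satisfying $\epsilon\le\min\{\rho_g/\rho_f,\bar\sigma,1\}$. Then for every $0\le t\le T-1$ the numbers of inner iterations $K_t$ and $N_t$ satisfy $$K_t\le\frac{\log(\bar C_b/\epsilon_z^2)}{\log(1/(1-p_g))},\qquad N_t\le\frac{\log(\bar C_c/\epsilon_y^2)}{\log(1/(1-p_\sigma))},$$ where $p_g:=\frac{\mu(\alpha-1)}{2\alpha^2\max\{L_{0,1},L_g\}}$ and $p_\sigma:=\frac{\mu(\alpha-1)}{2\alpha^2\max\{L_{0,2},L_f+L_g\}}$ satisfy $0<p_g,p_\sigma<1$, and $\bar C_b,\bar C_c$ are the following constants. With $L_\sigma:=L_f+L_g$ and $\beta:=\frac{\alpha+1}{2}$, $$\bar C_b:=\frac{2L_g^2}{\mu}\,C_g\left(\frac{L_g^2}{\mu^3}\epsilon_z^2+\frac{L_g^4}{\mu^3a_0^2}C_\varphi^2\right),\qquad \bar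 C_c:=\frac{2L_\sigma^2}{\mu}\,C_{g_\sigma}\left(\frac{L_\sigma^2}{\mu^3}\epsilon_y^2+\frac{L_\sigma^4}{\mu^3a_0^2}C_\varphi^2\right),$$ $$C_g:=\left(\frac{1+D_g}{1-p_g}\right)^{m_g},\quad D_g:=\max\left\{\frac{L_g^3}{\mu\alpha^2L_{0,1}^2},\frac{L_g^2}{\mu\alpha^2L_{0,1}},\frac{\mu L_g}{\alpha^2L_{0,1}^2},\frac{\mu}{\alpha^2L_{0,1}}\right\},\quad m_g:=\left\lceil\log_\beta\frac{\max\{L_{0,1},L_g\}}{L_{0,1}}\right\rceil_+,$$ $$C_{g_\sigma}:=\left(\frac{1+D_\sigma}{1-p_\sigma}\right)^{m_\sigma},\quad D_\sigma:=\max\left\{\frac{L_\sigma^3}{\mu\alpha^2L_{0,2}^2},\frac{L_\sigma^2}{\mu\alpha^2L_{0,2}},\frac{\mu L_\sigma}{\alpha^2L_{0,2}^2},\frac{\mu}{\alpha^2L_{0,2}}\right\},\quad m_\sigma:=\left\lceil\log_\beta\frac{\max\{L_{0,2},L_\sigma\}}{L_{0,2}}\right\rceil_+,$$ $$C_\varphi:=\Big(l_f+\frac{L_gl_f}{\mu}\Big)+\bar C_\sigma+\frac{L_f}{\mu}+\frac{2L_g}{\mu}.$$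
   Context: PŁ condition: $h:\mathbb{R}^d\to\mathbb{R}$ with minimum value $h^*=\min h$ is $\mu$-PŁ ($\mu>0$) if $2\mu(h(x)-h^* )\le\|\nabla h(x)\|^2$ for all $x$. (All minima written as $\min$ are understood to be attained.) $\lceil a\rceil_+$ denotes the smallest nonnegative integer greater than or equal to $a$. $Y^*(x)=\arg\min_yg(x,y)$, $g^*(x)=\min_yg(x,y)$, $\varphi(x)=\min_{y\in Y^*(x)}f(x,y)$, and for $\sigma>0$, $\varphi_\sigma(x)=\min_y\{f(x,y)+(g(x,y)-g^*(x))/\sigma\}$. Under assumptions (1)--(5) $\varphi$ and $\varphi_\sigma$ are differentiable, and $\bar C_\sigma$ denotes a constant, depending only on $\mu$ and the Lipschitz constants, such that $\|\nabla\varphi_\sigma(x)-\nabla\varphi(x)\|\le\bar C_\sigma\sigma$ for all $x$ and all $0<\sigma\le\min\{\rho_g/\rho_f,\bar\sigma\}$ (known result). Algorithm A$^2$F$^2$BA. Inputs: $x_0,y_0,z_0$; $a_0>0$; $\alpha>1$; $L_{0,1},L_{0,2}>0$; $\epsilon>0$. Set $T=1/\epsilon^2$ (understood as an integer), $\epsilon_z=\epsilon_y=\epsilon^2$, $\sigma=\epsilon$. For $t=0,\dots,T-1$: (i) let $z_t^0=z_{t-1}^{K_{t-1}}$ if $t>0$ and $z_0^0=z_0$; compute $(z_t^{K_t},K_t)=\text{AC-GM}(g(x_t,\cdot),z_t^0,\alpha,L_{0,1},\epsilon_z)$; (ii) let $y_t^0=y_{t-1}^{N_{t-1}}$ if $t>0$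 and $y_0^0=y_0$; compute $(y_t^{N_t},N_t)=\text{AC-GM}(\sigma f(x_t,\cdot)+g(x_t,\cdot),y_t^0,\alpha,L_{0,2},\epsilon_y)$; (iii) $\widehat\nabla_t=\nabla_xf(x_t,y_t^{N_t})+\big(\nabla_xg(x_t,y_t^{N_t})-\nabla_xg(x_t,z_t^{K_t})\big)/\sigma$, $a_{t+1}=\sqrt{a_t^2+\|\widehat\nabla_t\|^2}$, $x_{t+1}=x_t-\widehat\nabla_t/a_{t+1}$. $\text{AC-GM}(h,x^0,\alpha,L_0,\epsilon_h)$: start with $k=0$; while $\|\nabla h(x^k)\|>\epsilon_h$, set $\gamma_{k+1}=\max\{L_0,\dots,L_k\}$, $x^{k+1}=x^k-\frac{1}{\alpha\gamma_{k+1}}\nabla h(x^k)$, $L_{k+1}=\frac{2(h(x^{k+1})-h(x^k)-\langle\nabla h(x^k),x^{k+1}-x^k\rangle)}{\|x^{k+1}-x^k\|^2}$, $k\leftarrow k+1$. Return $(x^k,k)$.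
   Formalization: For t=0 the bounds on K_0, N_0 are claimed only if the initial gaps at z_0, y_0 are at most C̄_b/(2L_g C_g), C̄_c/(2L_σ C_{g_σ}) (false for far-away starts); μ≤L_g is assumed, automatic unless f and g do not depend on y, where p_g<1 can fail. *)

theory Defs
  imports "HOL-Analysis.Analysis"
begin

section \<open>Smoothness classes and the PL condition\<close>

definition grad :: "('a::real_inner \<Rightarrow> real) \<Rightarrow> 'a \<Rightarrow> 'a" where
  "grad h x = (THE D. GDERIV h x :> D)"

definition has_lipschitz_gradient :: "real \<Rightarrow> ('a::real_inner \<Rightarrow> real) \<Rightarrow> bool" where
  "has_lipschitz_gradient L h \<longleftrightarrow>
     (\<forall>x. GDERIV h x :> grad h x) \<and> L-lipschitz_on UNIV (grad h)"

text \<open>The Hessian is the derivative of the gradient; its Lipschitz constant is measured in the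
  operator norm, the norm of the type of bounded linear maps.\<close>

definition has_lipschitz_hessian :: "real \<Rightarrow> ('a::real_inner \<Rightarrow> real) \<Rightarrow> bool" where
  "has_lipschitz_hessian \<rho> h \<longleftrightarrow>
     (\<forall>x. GDERIV h x :> grad h x) \<and>
     (\<exists>H :: 'a \<Rightarrow> 'a \<Rightarrow>\<^sub>L 'a.
        (\<forall>x. (grad h has_derivative blinfun_apply (H x)) (at x)) \<and> \<rho>-lipschitz_on UNIV H)"

definition attains_min_on :: "('a \<Rightarrow> real) \<Rightarrow> 'a set \<Rightarrow> bool" where
  "attains_min_on h S \<longleftrightarrow> (\<exists>x\<in>S. \<forall>y\<in>S. h x \<le> h y)"

definition PL :: "real \<Rightarrow> ('a::real_inner \<Rightarrow> real) \<Rightarrow> bool" where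
  "PL \<mu> h \<longleftrightarrow> 0 < \<mu> \<and> (\<forall>x. GDERIV h x :> grad h x) \<and> attains_min_on h UNIV \<and>
     (\<forall>x. 2 * \<mu> * (h x - (INF y. h y)) \<le> (norm (grad h x))\<^sup>2)"


section \<open>The bilevel problem\<close>

text \<open>Minimum values are written as infima; they are minima wherever they are attained.\<close>

definition lower_sol :: "('a \<times> 'b \<Rightarrow> real) \<Rightarrow> 'a \<Rightarrow> 'b set" where
  "lower_sol g x = {y. \<forall>y'. g (x, y) \<le> g (x, y')}"

definition lower_val :: "('a \<times> 'b \<Rightarrow> real) \<Rightarrow> 'a \<Rightarrow> real" where
  "lower_val g x = (INF y. g (x, y))"

definition hyper_obj :: "('a \<times> 'b \<Rightarrow> real) \<Rightarrow> ('a \<times> 'b \<Rightarrow> real) \<Rightarrow> 'a \<Rightarrow> real" where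
  "hyper_obj f g x = (INF y\<in>lower_sol g x. f (x, y))"

definition penalty_obj ::
  "('a \<times> 'b \<Rightarrow> real) \<Rightarrow> ('a \<times> 'b \<Rightarrow> real) \<Rightarrow> real \<Rightarrow> 'a \<Rightarrow> real" where
  "penalty_obj f g \<sigma> x = (INF y. f (x, y) + (g (x, y) - lower_val g x) / \<sigma>)"


section \<open>The inner solver AC-GM\<close>

text \<open>The state after \<open>k\<close> iterations is the pair of the iterate \<open>x\<^sup>k\<close> and the running
  maximum \<open>max {L\<^sub>0, \<dots>, L\<^sub>k}\<close>, which is the value of \<open>\<gamma>\<close> used in the next step.
  The stopping test is ignored here: the sequence is simply continued past it.\<close>

primrec acgm_state ::
  "('a::real_inner \<Rightarrow> real) \<Rightarrow> 'a \<Rightarrow> real \<Rightarrow> real \<Rightarrow> nat \<Rightarrow> 'a \<times> real" where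
  "acgm_state h x0 \<alpha> L0 0 = (x0, L0)"
| "acgm_state h x0 \<alpha> L0 (Suc k) =
    (let (x, \<gamma>) = acgm_state h x0 \<alpha> L0 k;
         x' = x - (1 / (\<alpha> * \<gamma>)) *\<^sub>R grad h x;
         L' = 2 * (h x' - h x - grad h x \<bullet> (x' - x)) / (norm (x' - x))\<^sup>2
     in (x', max \<gamma> L'))"

definition acgm_stop ::
  "('a::real_inner \<Rightarrow> real) \<Rightarrow> 'a \<Rightarrow> real \<Rightarrow> real \<Rightarrow> real \<Rightarrow> nat \<Rightarrow> bool" where
  "acgm_stop h x0 \<alpha> L0 \<epsilon> k \<longleftrightarrow> norm (grad h (fst (acgm_state h x0 \<alpha> L0 k))) \<le> \<epsilon>"

definition acgm_terminates ::
  "('a::real_inner \<Rightarrow> real) \<Rightarrow> 'a \<Rightarrow> real \<Rightarrow> real \<Rightarrow> real \<Rightarrow> bool" where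
  "acgm_terminates h x0 \<alpha> L0 \<epsilon> \<longleftrightarrow> (\<exists>k. acgm_stop h x0 \<alpha> L0 \<epsilon> k)"

text \<open>The pair of the returned point and the number of iterations. It is meaningful only if
  \<open>acgm_terminates\<close> holds; otherwise the \<open>LEAST\<close> is unspecified.\<close>

definition acgm ::
  "('a::real_inner \<Rightarrow> real) \<Rightarrow> 'a \<Rightarrow> real \<Rightarrow> real \<Rightarrow> real \<Rightarrow> 'a \<times> nat" where
  "acgm h x0 \<alpha> L0 \<epsilon> =
     (let k = (LEAST k. acgm_stop h x0 \<alpha> L0 \<epsilon> k) in (fst (acgm_state h x0 \<alpha> L0 k), k))"


section \<open>The outer algorithm\<close>

text \<open>Starting point of the inner solver at step \<open>t\<close>: the given initial point if \<open>t = 0\<close>, and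
  the output of the preceding step otherwise.\<close>

definition warm_start :: "'a \<Rightarrow> (nat \<Rightarrow> 'a) \<Rightarrow> nat \<Rightarrow> 'a" where
  "warm_start w0 w t = (case t of 0 \<Rightarrow> w0 | Suc s \<Rightarrow> w s)"

definition hypergrad_est ::
  "('a::real_inner \<times> 'b \<Rightarrow> real) \<Rightarrow> ('a \<times> 'b \<Rightarrow> real) \<Rightarrow> real \<Rightarrow> 'a \<Rightarrow> 'b \<Rightarrow> 'b \<Rightarrow> 'a" where
  "hypergrad_est f g \<sigma> x y z =
     grad (\<lambda>u. f (u, y)) x
       + (1 / \<sigma>) *\<^sub>R (grad (\<lambda>u. g (u, y)) x - grad (\<lambda>u. g (u, z)) x)"

text \<open>\<open>z t\<close> and \<open>y t\<close> are the outputs of the two inner solvers at step \<open>t\<close>, and \<open>K t\<close>, \<open>N t\<close>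
  their iteration counts. The tolerances are \<open>\<epsilon>\<^sub>z = \<epsilon>\<^sub>y = \<epsilon>\<^sup>2\<close> and the penalty
  parameter is \<open>\<sigma> = \<epsilon>\<close>.\<close>

definition a2f2ba_run ::
  "('a::real_inner \<times> 'b::real_inner \<Rightarrow> real) \<Rightarrow> ('a \<times> 'b \<Rightarrow> real) \<Rightarrow>
   'a \<Rightarrow> 'b \<Rightarrow> 'b \<Rightarrow> real \<Rightarrow> real \<Rightarrow> real \<Rightarrow> real \<Rightarrow> real \<Rightarrow> nat \<Rightarrow>
   (nat \<Rightarrow> 'a) \<Rightarrow> (nat \<Rightarrow> real) \<Rightarrow> (nat \<Rightarrow> 'b) \<Rightarrow> (nat \<Rightarrow> 'b) \<Rightarrow> (nat \<Rightarrow> nat) \<Rightarrow> (nat \<Rightarrow> nat) \<Rightarrow> bool"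
where
  "a2f2ba_run f g x0 y0 z0 a0 \<alpha> L01 L02 \<epsilon> T x a y z K N \<longleftrightarrow>
     x 0 = x0 \<and> a 0 = a0 \<and>
     (\<forall>t<T.
        (z t, K t) = acgm (\<lambda>v. g (x t, v)) (warm_start z0 z t) \<alpha> L01 (\<epsilon>\<^sup>2) \<and>
        (y t, N t) = acgm (\<lambda>v. \<epsilon> * f (x t, v) + g (x t, v)) (warm_start y0 y t) \<alpha> L02 (\<epsilon>\<^sup>2) \<and>
        a (Suc t) = sqrt ((a t)\<^sup>2 + (norm (hypergrad_est f g \<epsilon> (x t) (y t) (z t)))\<^sup>2) \<and>
        x (Suc t) = x t - (1 / a (Suc t)) *\<^sub>R hypergrad_est f g \<epsilon> (x t) (y t) (z t))"


section \<open>The constants\<close>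

text \<open>The constants come in two versions of the same form: those for the lower-level problem are
  obtained with \<open>L0 = L\<^sub>0\<^sub>,\<^sub>1\<close>, \<open>L = L\<^sub>g\<close>, those for the penalised one with
  \<open>L0 = L\<^sub>0\<^sub>,\<^sub>2\<close>, \<open>L = L\<^sub>\<sigma> = L\<^sub>f + L\<^sub>g\<close>.\<close>

definition rate_p :: "real \<Rightarrow> real \<Rightarrow> real \<Rightarrow> real \<Rightarrow> real" where
  "rate_p \<mu> \<alpha> L0 L = \<mu> * (\<alpha> - 1) / (2 * \<alpha>\<^sup>2 * max L0 L)"

definition const_D :: "real \<Rightarrow> real \<Rightarrow> real \<Rightarrow> real \<Rightarrow> real" where
  "const_D \<mu> \<alpha> L0 L = Max {L^3 / (\<mu> * \<alpha>\<^sup>2 * L0\<^sup>2), L\<^sup>2 / (\<mu> * \<alpha>\<^sup>2 * L0),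
                            \<mu> * L / (\<alpha>\<^sup>2 * L0\<^sup>2), \<mu> / (\<alpha>\<^sup>2 * L0)}"

definition const_m :: "real \<Rightarrow> real \<Rightarrow> real \<Rightarrow> nat" where
  "const_m \<alpha> L0 L = nat \<lceil>log ((\<alpha> + 1) / 2) (max L0 L / L0)\<rceil>"

definition const_C :: "real \<Rightarrow> real \<Rightarrow> real \<Rightarrow> real \<Rightarrow> real" where
  "const_C \<mu> \<alpha> L0 L = ((1 + const_D \<mu> \<alpha> L0 L) / (1 - rate_p \<mu> \<alpha> L0 L)) ^ const_m \<alpha> L0 L"

definition C_phi :: "real \<Rightarrow> real \<Rightarrow> real \<Rightarrow> real \<Rightarrow> real \<Rightarrow> real" where
  "C_phi \<mu> lf Lf Lg C\<sigma> = (lf + Lg * lf / \<mu>) + C\<sigma> + Lf / \<mu> + 2 * Lg / \<mu>"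

definition C_bar :: "real \<Rightarrow> real \<Rightarrow> real \<Rightarrow> real \<Rightarrow> real \<Rightarrow> real \<Rightarrow> real \<Rightarrow> real" where
  "C_bar \<mu> \<alpha> L0 L a0 \<delta> C\<phi> =
     2 * L\<^sup>2 / \<mu> * const_C \<mu> \<alpha> L0 L * (L\<^sup>2 / \<mu>^3 * \<delta>\<^sup>2 + L^4 / (\<mu>^3 * a0\<^sup>2) * C\<phi>\<^sup>2)"

text \<open>\<open>C_bar\<close> equals \<open>2 * L * const_C * warm_gap\<close>: the constant \<open>warm_gap\<close> is the bound on the
  initial optimality gap of the inner problem that enters \<open>C_bar\<close>. For \<open>t > 0\<close> warm starting
  guarantees this gap; for \<open>t = 0\<close> it is a condition on the initial points, without which the
  iteration bounds fail, since no constant in them depends on \<open>y0\<close> and \<open>z0\<close>.\<close>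

definition warm_gap :: "real \<Rightarrow> real \<Rightarrow> real \<Rightarrow> real \<Rightarrow> real \<Rightarrow> real" where
  "warm_gap \<mu> L a0 \<delta> C\<phi> =
     L / \<mu> * (L\<^sup>2 / \<mu>^3 * \<delta>\<^sup>2 + L^4 / (\<mu>^3 * a0\<^sup>2) * C\<phi>\<^sup>2)"

end

theory Submission
  imports Defs
begin

text \<open>Write \<open>\<gamma>\<close> for the running maximum in AC-GM and \<open>L'\<close> for the next local smoothness estimate. A
  step with \<open>L' \<le> \<beta> \<gamma>\<close> contracts the optimality gap by \<open>(1 - p)\<^sup>2\<close>; any other step multiplies \<open>\<gamma>\<close> by
  more than \<open>\<beta>\<close>, so there are few of them, and each increases the gap by a factor of at most
  \<open>1 + D\<close>. Hence the gap decays geometrically, and the squared gradient norm with it.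

  The gap at the warm start is controlled by the PL inequality: there the gradient has norm at most
  the tolerance plus \<open>L\<close> times the outer step, and the outer step is at most \<open>C\<phi> / a0\<close> because the
  hypergradient estimates are bounded by \<open>C\<phi>\<close>. The latter uses that a point \<open>v\<close> has distance at
  most \<open>norm (grad h v) / \<mu>\<close> from the minimizers of a PL function \<open>h\<close>.\<close>

section \<open>Gradients\<close>

lemma grad_eqI:
  assumes "GDERIV h x :> D"
  shows "grad h x = D"
  unfolding grad_def
proof (rule the_equality)
  fix D' assume "GDERIV h x :> D'"
  then have "(\<lambda>v. v \<bullet> D') = (\<lambda>v. v \<bullet> D)"
    using assms unfolding gderiv_def by (rule has_derivative_unique)
  then have "\<forall>v. v \<bullet> D' = v \<bullet> D"
    by (simp add: fun_eq_iff)
  then show "D' = D"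
    using vector_eq_ldot by blast
qed (fact assms)

lemma GDERIV_line:
  assumes "GDERIV h (x + t *\<^sub>R d) :> D"
  shows "((\<lambda>t. h (x + t *\<^sub>R d)) has_real_derivative d \<bullet> D) (at t)"
proof -
  have "((\<lambda>t. x + t *\<^sub>R d) has_derivative (\<lambda>s. s *\<^sub>R d)) (at t)"
    by (auto intro!: derivative_eq_intros)
  from has_derivative_compose[OF this, of h "\<lambda>h. h \<bullet> D"] assms show ?thesis
    unfolding gderiv_def has_field_derivative_def
    by (simp add: mult_commute_abs)
qed

text \<open>Along the direction \<open>- D\<close> the difference quotients tend to
  \<open>- (norm D)\<^sup>2\<close>, while the lower bound keeps them above
  \<open>- c * norm D\<close>.\<close>

lemma norm_gradient_le:
  assumes D: "GDERIV h x :> D" and c: "0 \<le> c" and low: "\<And>u. h x - c * norm (u - x) \<le> h u"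
  shows "norm D \<le> c"
proof (cases "D = 0")
  case True
  then show ?thesis
    using c by simp
next
  case False
  have "((\<lambda>t. h (x + t *\<^sub>R (- D))) has_real_derivative (- D) \<bullet> D) (at 0)"
    by (rule GDERIV_line) (use D in simp)
  then have "((\<lambda>t. (h (x + t *\<^sub>R (- D)) - h x) / t) \<longlongrightarrow> - (norm D)\<^sup>2) (at 0)"
    by (simp add: has_field_derivative_iff power2_norm_eq_inner)
  then have "((\<lambda>t. (h (x + t *\<^sub>R (- D)) - h x) / t) \<longlongrightarrow> - (norm D)\<^sup>2) (at_right 0)"
    by (rule tendsto_within_subset) simp
  moreover have "\<forall>\<^sub>F t in at_right 0. - c * norm D \<le> (h (x + t *\<^sub>R (- D)) - h x) / t"
    using eventually_at_right_less[of "0::real"]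
  proof eventually_elim
    case (elim t)
    then show ?case
      using low[of "x + t *\<^sub>R (- D)"] by (simp add: field_simps)
  qed
  ultimately have "- c * norm D \<le> - (norm D)\<^sup>2"
    by (rule tendsto_lowerbound) simp
  then show ?thesis
    using False by (simp add: power2_eq_square)
qed

lemma smooth_upper:
  assumes "has_lipschitz_gradient L h"
  shows "h y \<le> h x + grad h x \<bullet> (y - x) + L / 2 * (norm (y - x))\<^sup>2"
proof -
  define d where "d = y - x"
  \<comment> \<open>Up to a constant, \<open>q\<close> is \<open>h\<close> along the segment minus
    its quadratic model; the Lipschitz gradient makes it nonincreasing on the unit interval.\<close>
  define q where "q t = h (x + t *\<^sub>R d) - t * (grad h x \<bullet> d) - L / 2 * t\<^sup>2 * (norm d)\<^sup>2" for t
  have G: "GDERIV h u :> grad h u" for u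
    using assms by (simp add: has_lipschitz_gradient_def)
  have lip: "norm (grad h u - grad h v) \<le> L * norm (u - v)" for u v
    using assms unfolding has_lipschitz_gradient_def by (metis UNIV_I lipschitz_on_normD)
  have "q 1 \<le> q 0"
  proof (rule DERIV_nonpos_imp_nonincreasing[where f = q])
    fix t :: real assume t: "0 \<le> t" "t \<le> 1"
    define q' where "q' = d \<bullet> grad h (x + t *\<^sub>R d) - grad h x \<bullet> d - L * t * (norm d)\<^sup>2"
    have "(q has_real_derivative q') (at t)"
      unfolding q_def q'_def
      by (rule derivative_eq_intros GDERIV_line G refl | simp)+
    moreover have "q' \<le> 0"
    proof -
      have "d \<bullet> (grad h (x + t *\<^sub>R d) - grad h x) \<le> norm d * norm (grad h (x + t *\<^sub>R d) - grad h x)"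
        by (rule norm_cauchy_schwarz)
      also have "\<dots> \<le> norm d * (L * norm (t *\<^sub>R d))"
        using lip[of "x + t *\<^sub>R d" x] by (intro mult_left_mono) auto
      finally show ?thesis
        using t by (simp add: q'_def inner_diff_right inner_commute power2_eq_square mult_ac)
    qed
    ultimately show "\<exists>q'. DERIV q t :> q' \<and> q' \<le> 0"
      by blast
  qed simp
  then show ?thesis
    by (simp add: q_def d_def)
qed

section \<open>Partial gradients of functions on a product space\<close>

lemma GDERIV_slice_snd:
  fixes F :: "'a::real_inner \<times> 'b::real_inner \<Rightarrow> real"
  assumes "GDERIV F (x, y) :> D"
  shows "GDERIV (\<lambda>v. F (x, v)) y :> snd D"
proof -
  have "((\<lambda>v. (x, v)) has_derivative (\<lambda>v. (0, v))) (at y)"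
    by (auto intro!: derivative_eq_intros)
  from has_derivative_compose[OF this, of F "\<lambda>h. h \<bullet> D"] assms show ?thesis
    unfolding gderiv_def by (simp add: inner_prod_def)
qed

lemma GDERIV_slice_fst:
  fixes F :: "'a::real_inner \<times> 'b::real_inner \<Rightarrow> real"
  assumes "GDERIV F (x, y) :> D"
  shows "GDERIV (\<lambda>u. F (u, y)) x :> fst D"
proof -
  have "((\<lambda>u. (u, y)) has_derivative (\<lambda>u. (u, 0))) (at x)"
    by (auto intro!: derivative_eq_intros)
  from has_derivative_compose[OF this, of F "\<lambda>h. h \<bullet> D"] assms show ?thesis
    unfolding gderiv_def by (simp add: inner_prod_def)
qed

context
  fixes F :: "'a::real_inner \<times> 'b::real_inner \<Rightarrow> real" and L :: real
  assumes F: "has_lipschitz_gradient L F"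
begin

lemma smooth_GDERIV: "GDERIV F p :> grad F p"
  using F unfolding has_lipschitz_gradient_def by blast

lemma smooth_norm_diff: "norm (grad F p - grad F q) \<le> L * norm (p - q)"
  using F unfolding has_lipschitz_gradient_def by (metis UNIV_I lipschitz_on_normD)

lemma smooth_nonneg: "0 \<le> L"
  using F unfolding has_lipschitz_gradient_def by (blast dest: lipschitz_on_nonneg)

lemma grad_slice_snd: "grad (\<lambda>v. F (x, v)) y = snd (grad F (x, y))"
  by (intro grad_eqI GDERIV_slice_snd smooth_GDERIV)

lemma grad_slice_fst: "grad (\<lambda>u. F (u, y)) x = fst (grad F (x, y))"
  by (intro grad_eqI GDERIV_slice_fst smooth_GDERIV)

text \<open>Both arguments may move at once: inner gradients are compared across slices, which is
  how a change of the outer variable is tracked.\<close>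

lemma norm_grad_slice_snd_diff:
  "norm (grad (\<lambda>v. F (x, v)) y - grad (\<lambda>v. F (x', v)) y') \<le> L * norm ((x, y) - (x', y'))"
proof -
  have "norm (snd p) \<le> norm p" for p :: "'a \<times> 'b"
    using norm_snd_le[of "snd p" "fst p"] by simp
  from order_trans[OF this smooth_norm_diff] show ?thesis
    unfolding grad_slice_snd snd_diff[symmetric] .
qed

lemma norm_grad_slice_fst_diff:
  "norm (grad (\<lambda>u. F (u, y)) x - grad (\<lambda>u. F (u, y')) x') \<le> L * norm ((x, y) - (x', y'))"
proof -
  have "norm (fst p) \<le> norm p" for p :: "'a \<times> 'b"
    using norm_fst_le[of "fst p" "snd p"] by simp
  from order_trans[OF this smooth_norm_diff] show ?thesis
    unfolding grad_slice_fst fst_diff[symmetric] .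
qed

lemma smooth_slice_snd: "has_lipschitz_gradient L (\<lambda>v. F (x, v))"
  unfolding has_lipschitz_gradient_def
proof (intro conjI allI lipschitz_onI)
  fix v w :: 'b
  show "GDERIV (\<lambda>v. F (x, v)) v :> grad (\<lambda>v. F (x, v)) v"
    unfolding grad_slice_snd by (intro GDERIV_slice_snd smooth_GDERIV)
  show "dist (grad (\<lambda>v. F (x, v)) v) (grad (\<lambda>v. F (x, v)) w) \<le> L * dist v w"
    using norm_grad_slice_snd_diff[of x v x w] by (simp add: dist_norm norm_Pair)
qed (fact smooth_nonneg)

lemma smooth_slice_fst: "has_lipschitz_gradient L (\<lambda>u. F (u, y))"
  unfolding has_lipschitz_gradient_def
proof (intro conjI allI lipschitz_onI)
  fix u w :: 'a
  show "GDERIV (\<lambda>u. F (u, y)) u :> grad (\<lambda>u. F (u, y)) u"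
    unfolding grad_slice_fst by (intro GDERIV_slice_fst smooth_GDERIV)
  show "dist (grad (\<lambda>u. F (u, y)) u) (grad (\<lambda>u. F (u, y)) w) \<le> L * dist u w"
    using norm_grad_slice_fst_diff[of y u y w] by (simp add: dist_norm norm_Pair)
qed (fact smooth_nonneg)

end

section \<open>Smoothness of the penalised combinations\<close>

lemma GDERIV_cmult_add:
  assumes "GDERIV f x :> df" "GDERIV g x :> dg"
  shows "GDERIV (\<lambda>x. c * f x + g x) x :> c *\<^sub>R df + dg"
  using assms unfolding gderiv_def by (auto intro!: derivative_eq_intros simp: inner_add_right)

lemma grad_cmult_add:
  assumes "has_lipschitz_gradient Lf f" "has_lipschitz_gradient Lg g"
  shows "grad (\<lambda>x. c * f x + g x) x = c *\<^sub>R grad f x + grad g x"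
  using assms by (intro grad_eqI GDERIV_cmult_add) (auto simp: has_lipschitz_gradient_def)

text \<open>The weight is absorbed through \<open>c \<le> 1\<close>, which leaves a constant
  independent of the penalty parameter.\<close>

lemma smooth_cmult_add:
  assumes f: "has_lipschitz_gradient Lf f" and g: "has_lipschitz_gradient Lg g"
    and c: "0 \<le> c" "c \<le> 1"
  shows "has_lipschitz_gradient (Lf + Lg) (\<lambda>x. c * f x + g x)"
proof -
  have "(c * Lf + Lg)-lipschitz_on UNIV (\<lambda>x. c *\<^sub>R grad f x + grad g x)"
    using f g c lipschitz_on_cmult[of Lf UNIV "grad f" c] unfolding has_lipschitz_gradient_def
    by (intro lipschitz_on_add) auto
  moreover have "0 \<le> Lf"
    using f unfolding has_lipschitz_gradient_def by (blast dest: lipschitz_on_nonneg)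
  ultimately have "(Lf + Lg)-lipschitz_on UNIV (\<lambda>x. c *\<^sub>R grad f x + grad g x)"
    using c by (elim lipschitz_on_mono) (auto simp: mult_left_le_one_le)
  then show ?thesis
    using f g unfolding has_lipschitz_gradient_def grad_cmult_add[OF f g]
    by (auto intro: GDERIV_cmult_add)
qed

section \<open>The PL condition\<close>

definition gap :: "('a \<Rightarrow> real) \<Rightarrow> 'a \<Rightarrow> real" where
  "gap h x = h x - (INF y. h y)"

definition minimizers :: "('a \<Rightarrow> real) \<Rightarrow> 'a set" where
  "minimizers h = {x. \<forall>y. h x \<le> h y}"

lemma gap_diff:
  fixes h :: "'a \<Rightarrow> real"
  shows "gap h x - gap h y = h x - h y"
  by (simp add: gap_def)

text \<open>A minimizer bounds the values from below, so the real-valued \<open>INF\<close> is a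
  true minimum here.\<close>

lemma gap_minimizer:
  assumes "x \<in> minimizers h"
  shows "gap h x = 0"
proof -
  have "h x \<le> h y" for y
    using assms by (simp add: minimizers_def)
  then have "(INF y. h y) = h x"
    by (intro antisym cINF_lower cINF_greatest bdd_belowI2[where m = "h x"]) auto
  then show ?thesis
    by (simp add: gap_def)
qed

text \<open>A constant function satisfies the PL inequality for every positive \<open>\<mu>\<close>,
  so \<open>\<mu> \<le> L\<close> is assumed. It keeps the contraction rate below 1 and
  \<open>L / \<mu>\<close> at least 1.\<close>

locale smooth_PL =
  fixes h :: "'a::real_inner \<Rightarrow> real" and \<mu> L :: real
  assumes PL: "PL \<mu> h" and smooth: "has_lipschitz_gradient L h" and mu_le: "\<mu> \<le> L"
begin

lemma mu_pos: "0 < \<mu>"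
  using PL by (simp add: PL_def)

lemma L_pos: "0 < L"
  using mu_pos mu_le by simp

lemma deriv: "GDERIV h x :> grad h x"
  using PL by (simp add: PL_def)

lemma minimizers_nonempty: "minimizers h \<noteq> {}"
  using PL by (auto simp: PL_def attains_min_on_def minimizers_def)

lemma gap_nonneg: "0 \<le> gap h x"
proof -
  obtain w where w: "w \<in> minimizers h"
    using minimizers_nonempty by blast
  then have "h w \<le> h x"
    by (simp add: minimizers_def)
  then show ?thesis
    using gap_diff[of h x w] gap_minimizer[OF w] by simp
qed

lemma minimizers_iff: "x \<in> minimizers h \<longleftrightarrow> gap h x = 0"
proof
  assume "gap h x = 0"
  then have "h x \<le> h y" for y
    using gap_nonneg[of y] gap_diff[of h y x] by simp
  then show "x \<in> minimizers h"
    by (simp add: minimizers_def)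
qed (rule gap_minimizer)

lemma PL_gap: "2 * \<mu> * gap h x \<le> (norm (grad h x))\<^sup>2"
  using PL by (simp add: PL_def gap_def)

text \<open>A gradient step of length \<open>1 / L\<close> lowers \<open>h\<close> by at least
  \<open>(norm (grad h x))\<^sup>2 / (2 * L)\<close>, and it cannot pass below the minimum.\<close>

lemma norm_grad_sq_le: "(norm (grad h x))\<^sup>2 \<le> 2 * L * gap h x"
proof -
  let ?y = "x - (1 / L) *\<^sub>R grad h x"
  have "h ?y \<le> h x + grad h x \<bullet> (?y - x) + L / 2 * (norm (?y - x))\<^sup>2"
    by (rule smooth_upper[OF smooth])
  also have "\<dots> = h x - (norm (grad h x))\<^sup>2 / (2 * L)"
    using L_pos by (simp add: dot_square_norm power_divide) (simp add: field_simps power2_eq_square)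
  finally have "(norm (grad h x))\<^sup>2 / (2 * L) \<le> gap h x"
    using gap_nonneg[of ?y] gap_diff[of h x ?y] by simp
  then show ?thesis
    using L_pos by (simp add: field_simps)
qed

lemma grad_minimizer: "x \<in> minimizers h \<Longrightarrow> grad h x = 0"
  using norm_grad_sq_le[of x] by (simp add: gap_minimizer)

text \<open>The gradient of the square root is \<open>grad h x / (2 * sqrt (gap h x))\<close>. The
  PL inequality cancels the gap in its squared norm and leaves at least
  \<open>\<mu> / 2\<close>.\<close>

lemma sqrt_gap_gradient:
  assumes "x \<notin> minimizers h"
  obtains D where "GDERIV (\<lambda>x. sqrt (gap h x)) x :> D" "sqrt (\<mu> / 2) \<le> norm D"
proof
  have pos: "0 < gap h x"
    using assms gap_nonneg[of x] by (simp add: minimizers_iff)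
  define D where "D = (inverse (sqrt (gap h x)) / 2) *\<^sub>R grad h x"
  have "GDERIV (gap h) x :> grad h x"
    using GDERIV_diff[OF deriv[of x] GDERIV_const] by (simp add: gap_def[abs_def])
  then show "GDERIV (\<lambda>x. sqrt (gap h x)) x :> D"
    unfolding D_def by (rule GDERIV_DERIV_compose) (rule DERIV_real_sqrt[OF pos])
  have "\<mu> / 2 \<le> (norm D)\<^sup>2"
    using pos PL_gap[of x] by (simp add: D_def power_mult_distrib field_simps)
  then show "sqrt (\<mu> / 2) \<le> norm D"
    by (simp add: real_le_lsqrt)
qed

end

section \<open>Error bound: the distance to the minimizers in finite dimension\<close>

locale euclidean_PL = smooth_PL h \<mu> L for h :: "'a::euclidean_space \<Rightarrow> real" and \<mu> L
begin

lemma continuous_gap: "continuous_on S (gap h)"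
proof -
  have "isCont h x" for x
    using deriv[of x] unfolding gderiv_def by (rule has_derivative_continuous)
  then show ?thesis
    unfolding gap_def[abs_def] by (intro continuous_intros continuous_at_imp_continuous_on ballI)
qed

lemma closed_minimizers: "closed (minimizers h)"
proof -
  have "minimizers h = gap h -` {0}"
    by (auto simp: minimizers_iff)
  then show ?thesis
    using continuous_closed_vimage[of "{0}" "gap h"] continuous_gap[of UNIV]
    by (simp add: continuous_on_eq_continuous_at)
qed

text \<open>A minimizer \<open>w\<close> of the penalised function \<open>sqrt (gap h w) + c * norm (w - x)\<close> must be a minimizer
  of \<open>h\<close>, since elsewhere \<open>sqrt (gap h)\<close> has slope larger than \<open>c\<close>.\<close>

lemma minimizer_near_weak:
  assumes c: "0 < c" "c < sqrt (\<mu> / 2)"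
  obtains w where "w \<in> minimizers h" "c * norm (w - x) \<le> sqrt (gap h x)"
proof -
  define q where "q w = sqrt (gap h w) + c * norm (w - x)" for w
  \<comment> \<open>Outside this ball the distance term alone exceeds \<open>q x\<close>, so a
    minimum over the compact ball is a global one.\<close>
  define B where "B = cball x (sqrt (gap h x) / c)"
  have "continuous_on B q"
    unfolding q_def by (intro continuous_intros continuous_gap)
  moreover have xB: "x \<in> B"
    using c gap_nonneg[of x] by (simp add: B_def)
  moreover have "compact B"
    by (simp add: B_def)
  ultimately have "\<exists>w\<in>B. \<forall>v\<in>B. q w \<le> q v"
    by (intro continuous_attains_inf) auto
  then obtain w where w: "w \<in> B" "\<And>v. v \<in> B \<Longrightarrow> q w \<le> q v"
    by auto
  have qx: "q x = sqrt (gap h x)"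
    by (simp add: q_def)
  have min: "q w \<le> q v" for v
  proof (cases "v \<in> B")
    case False
    then have "sqrt (gap h x) < c * norm (v - x)"
      using c by (simp add: B_def dist_norm norm_minus_commute field_simps)
    then have "q x \<le> q v"
      using gap_nonneg[of v] by (simp add: q_def qx add_increasing)
    then show ?thesis
      using w(2)[OF xB] by simp
  qed (rule w(2))
  have "w \<in> minimizers h"
  proof (rule ccontr)
    assume "w \<notin> minimizers h"
    then obtain D where D: "GDERIV (\<lambda>x. sqrt (gap h x)) w :> D" "sqrt (\<mu> / 2) \<le> norm D"
      by (rule sqrt_gap_gradient)
    \<comment> \<open>By the triangle inequality, minimality of \<open>q\<close> at \<open>w\<close>
      means that \<open>sqrt (gap h)\<close> falls away from \<open>w\<close> with slope at most
      \<open>c\<close>.\<close>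
    have "norm D \<le> c"
    proof (rule norm_gradient_le[OF D(1)])
      fix u
      have "c * norm (u - x) \<le> c * (norm (u - w) + norm (w - x))"
        using c norm_triangle_ineq[of "u - w" "w - x"] by (intro mult_left_mono) auto
      then show "sqrt (gap h w) - c * norm (u - w) \<le> sqrt (gap h u)"
        using min[of u] by (simp add: q_def distrib_left)
    qed (use c in simp)
    then show False
      using D(2) c by simp
  qed
  moreover have "c * norm (w - x) \<le> sqrt (gap h x)"
    using min[of x] real_sqrt_ge_zero[OF gap_nonneg[of w]] unfolding qx unfolding q_def by linarith
  ultimately show ?thesis
    by (rule that)
qed

text \<open>A nearest minimizer does not depend on \<open>c\<close>, so the weak bound can be pushed
  to the limit \<open>c = sqrt (\<mu> / 2)\<close>. This is quadratic growth of the gap, and the PL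
  inequality turns it into a bound by the gradient.\<close>

lemma minimizer_near:
  obtains w where "w \<in> minimizers h" "norm (x - w) \<le> norm (grad h x) / \<mu>"
proof -
  obtain w where w: "w \<in> minimizers h" "\<And>v. v \<in> minimizers h \<Longrightarrow> dist x w \<le> dist x v"
    using distance_attains_inf[OF closed_minimizers minimizers_nonempty, of x] by blast
  have "sqrt (\<mu> / 2) * norm (x - w) \<le> sqrt (gap h x)"
  proof (rule field_le_mult_one_interval)
    fix s :: real assume s: "0 < s" "s < 1"
    obtain v where v: "v \<in> minimizers h" "s * sqrt (\<mu> / 2) * norm (v - x) \<le> sqrt (gap h x)"
      by (rule minimizer_near_weak[of "s * sqrt (\<mu> / 2)" x]) (use s mu_pos in auto)
    have "norm (x - w) \<le> norm (v - x)"
      using w(2)[OF v(1)] by (simp add: dist_norm norm_minus_commute)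
    then have "s * sqrt (\<mu> / 2) * norm (x - w) \<le> s * sqrt (\<mu> / 2) * norm (v - x)"
      using s mu_pos by (intro mult_left_mono) auto
    then show "s * (sqrt (\<mu> / 2) * norm (x - w)) \<le> sqrt (gap h x)"
      using v(2) by (simp add: mult.assoc)
  qed
  then have "(sqrt (\<mu> / 2) * norm (x - w))\<^sup>2 \<le> gap h x"
    using mu_pos gap_nonneg[of x] by (intro sqrt_ge_absD) auto
  then have "2 * \<mu> * (\<mu> / 2 * (norm (x - w))\<^sup>2) \<le> 2 * \<mu> * gap h x"
    using mu_pos by (intro mult_left_mono) (auto simp: power_mult_distrib)
  also have "\<dots> \<le> (norm (grad h x))\<^sup>2"
    by (rule PL_gap)
  finally have "(\<mu> * norm (x - w))\<^sup>2 \<le> (norm (grad h x))\<^sup>2"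
    by (simp add: power2_eq_square mult_ac)
  then have "\<mu> * norm (x - w) \<le> norm (grad h x)"
    by (rule power2_le_imp_le) simp
  with w(1) show ?thesis
    using mu_pos by (intro that[of w]) (simp_all add: field_simps)
qed

end

text \<open>When the outer variable moves from \<open>x\<close> to \<open>u\<close>, the point
  \<open>w\<close> stays optimal up to an error quadratic in \<open>u - x\<close>. Hence
  \<open>g (u, v) - g (u, w)\<close> plus that error is minimal at \<open>u = x\<close>, and its
  gradient vanishes there.\<close>

lemma grad_fst_minimizer_unique:
  fixes g :: "'a::real_inner \<times> 'b::real_inner \<Rightarrow> real"
  assumes g: "has_lipschitz_gradient L g" and PL: "\<And>u. PL \<mu> (\<lambda>v. g (u, v))" and "\<mu> \<le> L"
    and v: "v \<in> minimizers (\<lambda>v. g (x, v))" and w: "w \<in> minimizers (\<lambda>v. g (x, v))"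
  shows "grad (\<lambda>u. g (u, v)) x = grad (\<lambda>u. g (u, w)) x"
proof -
  have slice: "smooth_PL (\<lambda>v. g (u, v)) \<mu> L" for u
    using PL smooth_slice_snd[OF g] \<open>\<mu> \<le> L\<close> by unfold_locales
  then have mu: "0 < \<mu>"
    by (rule smooth_PL.mu_pos)
  \<comment> \<open>From the PL inequality: the gap is at most
    \<open>(norm G)\<^sup>2 / (2 * \<mu>)\<close> for an inner gradient \<open>G\<close> of norm at
    most \<open>L * norm (u - x)\<close>.\<close>
  define C where "C = L\<^sup>2 / (2 * \<mu>)"
  define q where "q u = g (u, v) - g (u, w) + C * ((u - x) \<bullet> (u - x))" for u
  have "q x \<le> q u" for u
  proof -
    let ?G = "grad (\<lambda>v. g (u, v)) w"
    have "norm ?G \<le> L * norm (u - x)"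
      using norm_grad_slice_snd_diff[OF g, of u w x w] smooth_PL.grad_minimizer[OF slice w]
      by (simp add: norm_Pair)
    then have "(norm ?G)\<^sup>2 \<le> (L * norm (u - x))\<^sup>2"
      by (rule power_mono) simp
    with smooth_PL.PL_gap[OF slice, of u w] have "gap (\<lambda>v. g (u, v)) w \<le> C * ((u - x) \<bullet> (u - x))"
      using mu by (simp add: C_def dot_square_norm field_simps power_mult_distrib)
    moreover have "g (u, w) - gap (\<lambda>v. g (u, v)) w \<le> g (u, v)"
      using smooth_PL.gap_nonneg[OF slice, of u v] by (simp add: gap_def)
    moreover have "g (x, v) = g (x, w)"
      using v w by (simp add: minimizers_def order_antisym)
    ultimately show ?thesis
      by (simp add: q_def)
  qed
  moreover
  define D where "D = grad (\<lambda>u. g (u, v)) x - grad (\<lambda>u. g (u, w)) x"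
  have G: "((\<lambda>u. g (u, y)) has_derivative (\<lambda>h. h \<bullet> grad (\<lambda>u. g (u, y)) x)) (at x)" for y
    using smooth_slice_fst[OF g, of y] by (simp add: has_lipschitz_gradient_def gderiv_def)
  have "(q has_derivative (\<lambda>h. h \<bullet> D)) (at x)"
    unfolding q_def D_def
    by (auto intro!: derivative_eq_intros G simp: inner_diff_right)
  ultimately have "(\<lambda>h. h \<bullet> D) = (\<lambda>h. 0)"
    by (intro has_derivative_local_min[of q]) auto
  from fun_cong[OF this, of D] have "D \<bullet> D = 0"
    by simp
  then show ?thesis
    by (simp add: D_def)
qed

section \<open>The inner solver\<close>

text \<open>The value 1/8 comes from \<open>4 * (\<alpha> - 1) \<le> \<alpha>\<^sup>2\<close>, that
  is, from the square of \<open>\<alpha> - 2\<close>. Being below 1/2, it later gives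
  \<open>1 \<le> 2 * (1 - p)\<close>.\<close>

lemma rate_p_bounds:
  assumes "0 < \<mu>" "\<mu> \<le> L" "1 < \<alpha>" "0 < L0"
  shows "0 < rate_p \<mu> \<alpha> L0 L" and "rate_p \<mu> \<alpha> L0 L \<le> 1 / 8"
proof -
  let ?M = "max L0 L"
  have M: "0 < ?M" "\<mu> \<le> ?M"
    using assms by auto
  show "0 < rate_p \<mu> \<alpha> L0 L"
    using assms M(1) unfolding rate_p_def by simp
  have "\<mu> * (4 * (\<alpha> - 1)) \<le> ?M * \<alpha>\<^sup>2"
  proof (rule mult_mono)
    show "4 * (\<alpha> - 1) \<le> \<alpha>\<^sup>2"
      using zero_le_power2[of "\<alpha> - 2"] by (simp add: power2_eq_square algebra_simps)
  qed (use assms M in auto)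
  moreover have "0 < 2 * \<alpha>\<^sup>2 * ?M"
    using assms M by simp
  ultimately show "rate_p \<mu> \<alpha> L0 L \<le> 1 / 8"
    unfolding rate_p_def by (subst pos_divide_le_eq) (auto simp: algebra_simps)
qed

locale acgm_PL = smooth_PL h \<mu> L for h :: "'a::real_inner \<Rightarrow> real" and \<mu> L +
  fixes \<alpha> L0 :: real and x0 :: 'a
  assumes alpha: "1 < \<alpha>" and L0_pos: "0 < L0"
begin

abbreviation "p \<equiv> rate_p \<mu> \<alpha> L0 L"
abbreviation "D \<equiv> const_D \<mu> \<alpha> L0 L"
abbreviation "m \<equiv> const_m \<alpha> L0 L"
abbreviation "C \<equiv> const_C \<mu> \<alpha> L0 L"
abbreviation "iter k \<equiv> fst (acgm_state h x0 \<alpha> L0 k)"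
abbreviation "step_const k \<equiv> snd (acgm_state h x0 \<alpha> L0 k)"

definition "\<beta> = (\<alpha> + 1) / 2"

text \<open>\<open>step_const k\<close> is \<open>\<gamma>\<^sub>k\<^sub>+\<^sub>1\<close> and \<open>local_const k\<close> is \<open>L\<^sub>k\<^sub>+\<^sub>1\<close> in the notation of the algorithm.\<close>

definition "local_const k =
  2 * (h (iter (Suc k)) - h (iter k) - grad h (iter k) \<bullet> (iter (Suc k) - iter k)) /
    (norm (iter (Suc k) - iter k))\<^sup>2"

section \<open>Step constants and the change of the gap in one step\<close>

lemmas p_pos = rate_p_bounds(1)[OF mu_pos mu_le alpha L0_pos]
lemmas p_le = rate_p_bounds(2)[OF mu_pos mu_le alpha L0_pos]

lemma beta_gt: "1 < \<beta>"
  using alpha by (simp add: \<beta>_def)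

lemma iter_Suc: "iter (Suc k) = iter k - (1 / (\<alpha> * step_const k)) *\<^sub>R grad h (iter k)"
  by (simp add: case_prod_beta Let_def)

lemma step_const_Suc: "step_const (Suc k) = max (step_const k) (local_const k)"
  by (simp add: local_const_def case_prod_beta Let_def)

lemma local_const_le: "local_const k \<le> L"
proof (cases "iter (Suc k) = iter k")
  \<comment> \<open>The quotient is 0/0 here and has the value 0.\<close>
  case True
  then show ?thesis
    using L_pos unfolding local_const_def by simp
next
  case False
  then have "0 < (norm (iter (Suc k) - iter k))\<^sup>2"
    by simp
  then show ?thesis
    using smooth_upper[OF smooth, of "iter (Suc k)" "iter k"]
    unfolding local_const_def by (subst pos_divide_le_eq) (simp_all add: algebra_simps del: acgm_state.simps)
qed

lemma step_const_bounds: "L0 \<le> step_const k \<and> step_const k \<le> max L0 L"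
proof (induction k)
  case (Suc k)
  then show ?case
    unfolding step_const_Suc using local_const_le[of k] by auto
qed simp

text \<open>This is an equality because the local constant is defined to make the quadratic model
  exact at the next iterate.\<close>

lemma gap_Suc:
  "gap h (iter (Suc k)) = gap h (iter k)
     - (norm (grad h (iter k)))\<^sup>2 / (\<alpha> * step_const k)
     + local_const k * (norm (grad h (iter k)))\<^sup>2 / (2 * \<alpha>\<^sup>2 * (step_const k)\<^sup>2)"
proof -
  define \<gamma> where "\<gamma> = step_const k"
  define G where "G = grad h (iter k)"
  have \<gamma>: "0 < \<alpha> * \<gamma>"
    using step_const_bounds[of k] L0_pos alpha by (simp add: \<gamma>_def)
  have d: "iter (Suc k) - iter k = - (1 / (\<alpha> * \<gamma>)) *\<^sub>R G"
    unfolding iter_Suc G_def \<gamma>_def by simp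
  have "h (iter (Suc k)) - h (iter k) - G \<bullet> (iter (Suc k) - iter k)
      = local_const k * (norm (iter (Suc k) - iter k))\<^sup>2 / 2"
    unfolding local_const_def G_def by (cases "iter (Suc k) = iter k") (simp_all del: acgm_state.simps)
  moreover have "G \<bullet> (iter (Suc k) - iter k) = - ((norm G)\<^sup>2 / (\<alpha> * \<gamma>))"
    unfolding d by (simp add: dot_square_norm)
  moreover have "(norm (iter (Suc k) - iter k))\<^sup>2 = (norm G)\<^sup>2 / (\<alpha>\<^sup>2 * \<gamma>\<^sup>2)"
    unfolding d by (simp add: power_mult_distrib power_divide)
  ultimately show ?thesis
    using gap_diff[of h "iter (Suc k)" "iter k"] unfolding G_def[symmetric] \<gamma>_def[symmetric]
    by (simp del: acgm_state.simps)
qed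

text \<open>A step with \<open>L\<^sub>k\<^sub>+\<^sub>1 \<le> \<beta> \<gamma>\<^sub>k\<^sub>+\<^sub>1\<close> contracts twice as much as the rate \<open>p\<close> asks for. The surplus
  pays for the last iteration, at whose start the stopping test still fails.\<close>

lemma gap_good_step:
  assumes good: "local_const k \<le> \<beta> * step_const k"
  shows "gap h (iter (Suc k)) \<le> (1 - p)\<^sup>2 * gap h (iter k)"
proof -
  define \<gamma> where "\<gamma> = step_const k"
  define G2 where "G2 = (norm (grad h (iter k)))\<^sup>2"
  define \<delta> where "\<delta> = gap h (iter k)"
  have \<gamma>: "0 < \<gamma>" "\<gamma> \<le> max L0 L"
    using step_const_bounds[of k] L0_pos by (auto simp: \<gamma>_def)
  have PL': "2 * \<mu> * \<delta> \<le> G2" and \<delta>: "0 \<le> \<delta>"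
    unfolding G2_def \<delta>_def by (rule PL_gap, rule gap_nonneg)
  have p: "p \<le> \<mu> * (\<alpha> - 1) / (2 * \<alpha>\<^sup>2 * \<gamma>)"
    unfolding rate_p_def using \<gamma> alpha mu_pos by (intro divide_left_mono mult_left_mono) auto
  have "local_const k * G2 / (2 * \<alpha>\<^sup>2 * \<gamma>\<^sup>2) \<le> \<beta> * \<gamma> * G2 / (2 * \<alpha>\<^sup>2 * \<gamma>\<^sup>2)"
    using good unfolding \<gamma>_def[symmetric]
    by (intro divide_right_mono mult_right_mono) (auto simp: G2_def)
  then have "gap h (iter (Suc k)) \<le> \<delta> - G2 / (\<alpha> * \<gamma>) + \<beta> * \<gamma> * G2 / (2 * \<alpha>\<^sup>2 * \<gamma>\<^sup>2)"
    unfolding gap_Suc G2_def[symmetric] \<gamma>_def[symmetric] \<delta>_def[symmetric] by simp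
  \<comment> \<open>With \<open>\<beta> = (\<alpha> + 1) / 2\<close>, the terms
    \<open>1 / (\<alpha> * \<gamma>)\<close> and
    \<open>\<beta> / (2 * \<alpha>\<^sup>2 * \<gamma>)\<close> have the numerators
    \<open>4 * \<alpha>\<close> and \<open>\<alpha> + 1\<close> over a common denominator.\<close>
  also have "\<dots> = \<delta> - (3 * \<alpha> - 1) / (4 * \<alpha>\<^sup>2 * \<gamma>) * G2"
    using \<gamma> alpha unfolding \<beta>_def by (simp add: field_simps power2_eq_square)
  also have "\<dots> \<le> \<delta> - (3 * \<alpha> - 1) / (4 * \<alpha>\<^sup>2 * \<gamma>) * (2 * \<mu> * \<delta>)"
    using PL' \<gamma> alpha by (intro diff_left_mono mult_left_mono) auto
  also have "\<dots> \<le> \<delta> - (2 * (\<alpha> - 1)) / (4 * \<alpha>\<^sup>2 * \<gamma>) * (2 * \<mu> * \<delta>)"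
    using \<gamma> \<delta> alpha mu_pos by (intro diff_left_mono mult_right_mono divide_right_mono) auto
  also have "\<dots> = \<delta> - 2 * (\<mu> * (\<alpha> - 1) / (2 * \<alpha>\<^sup>2 * \<gamma>)) * \<delta>"
    using \<gamma> alpha by (simp add: field_simps)
  also have "\<dots> \<le> \<delta> - 2 * p * \<delta>"
    using p \<delta> by (intro diff_left_mono mult_right_mono mult_left_mono) auto
  also have "\<dots> \<le> (1 - p)\<^sup>2 * \<delta>"
    using \<delta> by (simp add: power2_eq_square algebra_simps)
  finally show ?thesis
    unfolding \<delta>_def .
qed

text \<open>The left side is the relative growth that a bad step can cause;
  \<open>\<mu> \<le> L\<close> puts it below the first entry of the maximum.\<close>

lemma D_ge: "L\<^sup>2 / (\<alpha>\<^sup>2 * L0\<^sup>2) \<le> D"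
proof -
  have "L\<^sup>2 / (\<alpha>\<^sup>2 * L0\<^sup>2) = \<mu> * L\<^sup>2 / (\<mu> * \<alpha>\<^sup>2 * L0\<^sup>2)"
    using mu_pos by simp
  also have "\<dots> \<le> L^3 / (\<mu> * \<alpha>\<^sup>2 * L0\<^sup>2)"
    using mu_pos mu_le by (intro divide_right_mono) (auto simp: power2_eq_square power3_eq_cube mult_right_mono)
  also have "\<dots> \<le> D"
    unfolding const_D_def by (rule Max_ge) auto
  finally show ?thesis .
qed

lemma D_nonneg: "0 \<le> D"
  by (rule order_trans[OF _ D_ge]) simp

text \<open>The decrease term is dropped; in the rest, \<open>L\<close> bounds the local constant,
  \<open>L0\<close> bounds the step constant from below, and \<open>norm_grad_sq_le\<close> bounds
  the gradient.\<close>

lemma gap_any_step: "gap h (iter (Suc k)) \<le> (1 + D) * gap h (iter k)"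
proof -
  define \<gamma> where "\<gamma> = step_const k"
  define G2 where "G2 = (norm (grad h (iter k)))\<^sup>2"
  define \<delta> where "\<delta> = gap h (iter k)"
  have \<gamma>: "L0 \<le> \<gamma>" "0 < \<gamma>"
    using step_const_bounds[of k] L0_pos by (auto simp: \<gamma>_def)
  have G2: "0 \<le> G2" "G2 \<le> 2 * L * \<delta>"
    unfolding G2_def \<delta>_def by (simp, rule norm_grad_sq_le)
  have \<delta>: "0 \<le> \<delta>"
    unfolding \<delta>_def by (rule gap_nonneg)
  have "gap h (iter (Suc k)) \<le> \<delta> + local_const k * G2 / (2 * \<alpha>\<^sup>2 * \<gamma>\<^sup>2)"
    unfolding gap_Suc G2_def[symmetric] \<gamma>_def[symmetric] \<delta>_def[symmetric]
    using G2 \<gamma> alpha by simp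
  also have "\<dots> \<le> \<delta> + L * (2 * L * \<delta>) / (2 * \<alpha>\<^sup>2 * L0\<^sup>2)"
  proof (intro add_left_mono frac_le)
    show "local_const k * G2 \<le> L * (2 * L * \<delta>)"
      using local_const_le[of k] G2 L_pos by (intro mult_mono) auto
    show "2 * \<alpha>\<^sup>2 * L0\<^sup>2 \<le> 2 * \<alpha>\<^sup>2 * \<gamma>\<^sup>2"
      using \<gamma> L0_pos by (intro mult_left_mono power_mono) auto
  qed (use L_pos \<delta> alpha L0_pos in auto)
  also have "\<dots> = \<delta> + L\<^sup>2 / (\<alpha>\<^sup>2 * L0\<^sup>2) * \<delta>"
    by (simp add: power2_eq_square)
  also have "\<dots> \<le> \<delta> + D * \<delta>"
    using \<delta> D_ge by (intro add_left_mono mult_right_mono)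
  finally show ?thesis
    unfolding \<delta>_def by (simp add: algebra_simps del: acgm_state.simps)
qed

text \<open>\<open>b\<close> counts the steps with \<open>L\<^sub>k\<^sub>+\<^sub>1 > \<beta> \<gamma>\<^sub>k\<^sub>+\<^sub>1\<close>. Each of them multiplies the running maximum
  by more than \<open>\<beta>\<close>; the strictness makes \<open>b\<close> smaller than \<open>m\<close>, not just at most \<open>m\<close>.\<close>

lemma gap_bound_steps:
  "\<exists>b\<le>k. \<beta> ^ b * L0 \<le> step_const k \<and> (b = 0 \<or> \<beta> ^ b * L0 < L) \<and>
     gap h (iter k) \<le> (1 + D) ^ b * (1 - p) ^ (2 * (k - b)) * gap h x0"
proof (induction k)
  case (Suc k)
  then obtain b where b: "b \<le> k" "\<beta> ^ b * L0 \<le> step_const k" "b = 0 \<or> \<beta> ^ b * L0 < L"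
    "gap h (iter k) \<le> (1 + D) ^ b * (1 - p) ^ (2 * (k - b)) * gap h x0"
    by blast
  show ?case
  proof (cases "local_const k \<le> \<beta> * step_const k")
    case True
    have "gap h (iter (Suc k)) \<le> (1 - p)\<^sup>2 * ((1 + D) ^ b * (1 - p) ^ (2 * (k - b)) * gap h x0)"
      by (rule order_trans[OF gap_good_step[OF True]]) (intro mult_left_mono b(4), simp)
    also have "\<dots> = (1 + D) ^ b * (1 - p) ^ (2 * (Suc k - b)) * gap h x0"
      using b(1) by (simp add: Suc_diff_le power2_eq_square mult_ac)
    finally have "gap h (iter (Suc k)) \<le> (1 + D) ^ b * (1 - p) ^ (2 * (Suc k - b)) * gap h x0" .
    then show ?thesis
      using b(1-3) by (intro exI[of _ b]) (auto simp: step_const_Suc simp del: acgm_state.simps)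
  next
    case False
    have "gap h (iter (Suc k)) \<le> (1 + D) * ((1 + D) ^ b * (1 - p) ^ (2 * (k - b)) * gap h x0)"
      by (rule order_trans[OF gap_any_step]) (intro mult_left_mono b(4), use D_nonneg in simp)
    then have "gap h (iter (Suc k)) \<le> (1 + D) ^ Suc b * (1 - p) ^ (2 * (Suc k - Suc b)) * gap h x0"
      by (simp add: mult.assoc del: acgm_state.simps)
    \<comment> \<open>The new local constant lies below both the new running maximum and
      \<open>L\<close>, so this one inequality restores both invariants on \<open>b\<close>.\<close>
    moreover have "\<beta> ^ Suc b * L0 < local_const k"
    proof -
      have "\<beta> * (\<beta> ^ b * L0) \<le> \<beta> * step_const k"
        using b(2) beta_gt by (intro mult_left_mono) auto
      then show ?thesis
        using False by (simp add: mult.assoc)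
    qed
    ultimately show ?thesis
      using b(1) local_const_le[of k]
      by (intro exI[of _ "Suc b"]) (auto simp: step_const_Suc simp del: acgm_state.simps power_Suc)
  qed
qed simp

text \<open>A natural number strictly below the logarithm is strictly below its ceiling. The factor
  of \<open>C\<close> thus left over is spent in \<open>gap_iter_le\<close>.\<close>

lemma bad_steps_less:
  assumes "\<beta> ^ b * L0 < L"
  shows "b < m"
proof -
  have "\<beta> powr real b < max L0 L / L0"
    using assms L0_pos beta_gt by (simp add: powr_realpow less_divide_eq less_max_iff_disj)
  moreover have "0 < \<beta> powr real b"
    using beta_gt by simp
  ultimately have "real b < log \<beta> (max L0 L / L0)"
    using beta_gt L0_pos by (subst less_log_iff) (auto simp: less_max_iff_disj)
  then show ?thesis
    unfolding const_m_def \<beta>_def[symmetric] by linarith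
qed

lemma C_base_ge: "1 \<le> (1 + D) / (1 - p)"
  using D_nonneg p_pos p_le by simp

lemma C_ge: "1 \<le> C"
  unfolding const_C_def by (rule one_le_power[OF C_base_ge])

text \<open>Without bad steps the exponent \<open>2 * k\<close> is at least \<open>k + 1\<close>,
  which needs \<open>1 \<le> k\<close>. Otherwise \<open>b + 1 \<le> m\<close>, and \<open>C\<close>
  pays for \<open>b + 1\<close> growth factors and as many missing contractions, since
  \<open>k - b = (k + 1) - (b + 1)\<close>.\<close>

lemma gap_iter_le:
  assumes "1 \<le> k"
  shows "gap h (iter k) \<le> C * (1 - p) ^ Suc k * gap h x0"
proof -
  obtain b where b: "b \<le> k" "b = 0 \<or> \<beta> ^ b * L0 < L"
    "gap h (iter k) \<le> (1 + D) ^ b * (1 - p) ^ (2 * (k - b)) * gap h x0"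
    using gap_bound_steps by blast
  have q: "0 < 1 - p" "1 - p \<le> 1"
    using p_pos p_le by auto
  have "(1 + D) ^ b * (1 - p) ^ (2 * (k - b)) \<le> C * (1 - p) ^ Suc k"
  proof (cases "b = 0")
    case True
    have "(1 - p) ^ (2 * k) \<le> (1 - p) ^ Suc k"
      using assms q by (intro power_decreasing) auto
    also have "\<dots> \<le> C * (1 - p) ^ Suc k"
      using C_ge q mult_right_mono[of 1 C "(1 - p) ^ Suc k"] by simp
    finally show ?thesis
      using True by simp
  next
    case False
    then have m: "Suc b \<le> m"
      using b(2) bad_steps_less[of b] by (simp add: Suc_le_eq)
    have "(1 + D) ^ b * (1 - p) ^ (2 * (k - b)) \<le> (1 + D) ^ Suc b * (1 - p) ^ (k - b)"
      using q D_nonneg by (intro mult_mono power_increasing power_decreasing) auto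
    also have "\<dots> = ((1 + D) / (1 - p)) ^ Suc b * (1 - p) ^ Suc k"
    proof -
      have "(1 - p) ^ Suc k = (1 - p) ^ Suc b * (1 - p) ^ (k - b)"
        using b(1) by (simp add: power_add[symmetric])
      then show ?thesis
        using q by (simp add: power_divide)
    qed
    also have "\<dots> \<le> C * (1 - p) ^ Suc k"
      unfolding const_C_def
      using q by (intro mult_right_mono power_increasing m C_base_ge) auto
    finally show ?thesis .
  qed
  then show ?thesis
    using b(3) mult_right_mono[OF _ gap_nonneg[of x0]] by (meson order_trans)
qed

section \<open>Termination and the iteration count\<close>

lemma terminates:
  assumes "0 < \<delta>"
  shows "acgm_terminates h x0 \<alpha> L0 \<delta>"
proof -
  have "(\<lambda>k. 2 * L * (C * (1 - p) ^ Suc k * gap h x0)) \<longlonglongrightarrow> 2 * L * (C * 0 * gap h x0)"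
    using p_pos p_le by (intro tendsto_intros LIMSEQ_Suc LIMSEQ_power_zero) auto
  then have "\<forall>\<^sub>F k in sequentially. 2 * L * (C * (1 - p) ^ Suc k * gap h x0) < \<delta>\<^sup>2"
    using assms by (intro order_tendstoD) auto
  with eventually_ge_at_top[of 1]
  have "\<forall>\<^sub>F k in sequentially. 1 \<le> k \<and> 2 * L * (C * (1 - p) ^ Suc k * gap h x0) < \<delta>\<^sup>2"
    by (rule eventually_conj)
  then obtain k where k: "1 \<le> k" "2 * L * (C * (1 - p) ^ Suc k * gap h x0) < \<delta>\<^sup>2"
    using eventually_happens'[OF sequentially_bot] by blast
  have "(norm (grad h (iter k)))\<^sup>2 \<le> 2 * L * gap h (iter k)"
    by (rule norm_grad_sq_le)
  also have "\<dots> \<le> 2 * L * (C * (1 - p) ^ Suc k * gap h x0)"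
    using gap_iter_le[OF k(1)] L_pos by (intro mult_left_mono) auto
  also have "\<dots> \<le> \<delta>\<^sup>2"
    using k(2) by simp
  finally have "norm (grad h (iter k)) \<le> \<delta>"
    by (rule power2_le_imp_le) (use assms in simp)
  then show ?thesis
    unfolding acgm_terminates_def acgm_stop_def by blast
qed

lemma norm_grad_acgm_le:
  assumes "0 < \<delta>" and "(z, K) = acgm h x0 \<alpha> L0 \<delta>"
  shows "norm (grad h z) \<le> \<delta>"
  using LeastI_ex[OF terminates[OF assms(1), unfolded acgm_terminates_def]] assms(2)
  by (simp add: acgm_def Let_def acgm_stop_def)

text \<open>The stopping test fails at iteration \<open>K - 1\<close>, where the decay estimate
  already carries the exponent \<open>K\<close>; taking logarithms gives the count.\<close>

lemma acgm_iterations_le: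
  assumes \<delta>: "0 < \<delta>" and acgm: "(z, K) = acgm h x0 \<alpha> L0 \<delta>"
    and W: "gap h x0 \<le> W" "\<delta>\<^sup>2 \<le> L * W"
  shows "real K \<le> ln (2 * L * C * W / \<delta>\<^sup>2) / ln (1 / (1 - p))"
proof -
  have q: "0 < 1 - p" "1 - p < 1"
    using p_pos p_le by auto
  have "\<delta>\<^sup>2 \<le> 2 * L * C * W * (1 - p) ^ K"
  proof (cases "K \<le> 1")
    \<comment> \<open>The decay estimate is available only from iteration 1 on, so
      \<open>K \<le> 1\<close> is settled by the lower bound on \<open>L * W\<close> and by
      \<open>1 \<le> 2 * (1 - p)\<close>.\<close>
    case True
    have "1 \<le> 2 * (1 - p)"
      using p_le by simp
    also have "\<dots> \<le> 2 * (1 - p) ^ K"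
      using True q by (cases "K = 0") (auto simp: le_Suc_eq)
    also have "\<dots> \<le> C * (2 * (1 - p) ^ K)"
      using mult_right_mono[OF C_ge, of "2 * (1 - p) ^ K"] q by simp
    finally have "\<delta>\<^sup>2 * 1 \<le> (L * W) * (C * (2 * (1 - p) ^ K))"
      using W(2) order_trans[OF zero_le_power2 W(2)] by (intro mult_mono) auto
    then show ?thesis
      by (simp add: mult_ac)
  next
    case False
    then obtain k where k: "K = Suc k" "1 \<le> k"
      by (cases K) auto
    have "\<not> acgm_stop h x0 \<alpha> L0 \<delta> k"
      using acgm k(1) by (intro not_less_Least) (simp add: acgm_def Let_def)
    then have "\<delta>\<^sup>2 \<le> (norm (grad h (iter k)))\<^sup>2"
      using \<delta> unfolding acgm_stop_def by (intro power_mono) auto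
    also have "\<dots> \<le> 2 * L * gap h (iter k)"
      by (rule norm_grad_sq_le)
    also have "\<dots> \<le> 2 * L * (C * (1 - p) ^ Suc k * W)"
    proof (rule mult_left_mono)
      show "gap h (iter k) \<le> C * (1 - p) ^ Suc k * W"
        using C_ge q by (intro order_trans[OF gap_iter_le[OF k(2)]] mult_left_mono W(1)) auto
    qed (use L_pos in simp)
    finally show ?thesis
      by (simp add: k(1) mult_ac)
  qed
  then have "(1 / (1 - p)) ^ K \<le> 2 * L * C * W / \<delta>\<^sup>2"
    using \<delta> q by (simp add: power_divide field_simps)
  moreover have "0 < (1 / (1 - p)) ^ K"
    using q by simp
  ultimately have "ln ((1 / (1 - p)) ^ K) \<le> ln (2 * L * C * W / \<delta>\<^sup>2)"
    by (intro ln_mono) auto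
  moreover have "0 < ln (1 / (1 - p))"
    using q by (intro ln_gt_zero) auto
  ultimately show ?thesis
    using q by (subst pos_le_divide_eq) (auto simp: ln_realpow)
qed

end

section \<open>The outer iteration\<close>

text \<open>The estimate is bounded directly, without the differentiability of \<open>hyper_obj\<close> or
  \<open>penalty_obj\<close>: a minimizer \<open>ys\<close> of the penalised problem is almost stationary for \<open>g\<close>, hence
  \<open>lf * \<sigma> / \<mu>\<close>-close to a minimizer \<open>ps\<close> of the lower-level problem, and the \<open>x\<close>-gradient of \<open>g\<close> does
  not depend on the choice of that minimizer.\<close>

lemma norm_hypergrad_est_le:
  fixes f g :: "'a::real_inner \<times> 'b::euclidean_space \<Rightarrow> real"
  assumes f: "lf-lipschitz_on UNIV f" "has_lipschitz_gradient Lf f"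
    and g: "has_lipschitz_gradient Lg g" and mu_le: "\<mu> \<le> Lg"
    and PLg: "\<And>u. PL \<mu> (\<lambda>v. g (u, v))" and PLs: "PL \<mu> (\<lambda>v. \<sigma> * f (x, v) + g (x, v))"
    and \<sigma>: "0 < \<sigma>" "\<sigma> \<le> 1"
    and z: "norm (grad (\<lambda>v. g (x, v)) z) \<le> \<sigma>\<^sup>2"
    and y: "norm (grad (\<lambda>v. \<sigma> * f (x, v) + g (x, v)) y) \<le> \<sigma>\<^sup>2"
  shows "norm (hypergrad_est f g \<sigma> x y z) \<le> lf + Lg * lf / \<mu> + 2 * Lg * \<sigma> / \<mu>"
proof -
  let ?g = "\<lambda>v. g (x, v)" and ?s = "\<lambda>v. \<sigma> * f (x, v) + g (x, v)"
  define G where "G v = grad (\<lambda>u. g (u, v)) x" for v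
  have lf: "0 \<le> lf"
    using f(1) by (rule lipschitz_on_nonneg)
  have Lf: "0 \<le> Lf" and Lg: "0 \<le> Lg"
    using f(2) g by (auto intro: smooth_nonneg)
  have low: "f p - lf * norm (q - p) \<le> f q" for p q
    using lipschitz_on_normD[OF f(1), of q p] by simp
  have sf: "has_lipschitz_gradient Lf (\<lambda>v. f (x, v))" and sg: "has_lipschitz_gradient Lg ?g"
    using f(2) g by (auto intro: smooth_slice_snd)
  have "euclidean_PL ?g \<mu> Lg"
    using PLg sg mu_le by unfold_locales
  interpret g: euclidean_PL ?g \<mu> Lg by fact
  have "has_lipschitz_gradient (Lf + Lg) ?s"
    using smooth_cmult_add[OF sf sg] \<sigma> by simp
  then have "euclidean_PL ?s \<mu> (Lf + Lg)"
    using PLs mu_le Lf by unfold_locales auto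
  interpret s: euclidean_PL ?s \<mu> "Lf + Lg" by fact
  note mu = g.mu_pos
  have G: "norm (G v - G w) \<le> Lg * norm (v - w)" for v w
    using norm_grad_slice_fst_diff[OF g, of v x w x] by (simp add: G_def norm_Pair)

  obtain zs where zs: "zs \<in> minimizers ?g" "norm (z - zs) \<le> norm (grad ?g z) / \<mu>"
    by (rule g.minimizer_near)
  obtain ys where ys: "ys \<in> minimizers ?s" "norm (y - ys) \<le> norm (grad ?s y) / \<mu>"
    by (rule s.minimizer_near)
  obtain ps where ps: "ps \<in> minimizers ?g" "norm (ys - ps) \<le> norm (grad ?g ys) / \<mu>"
    by (rule g.minimizer_near)

  have "norm (grad (\<lambda>v. f (x, v)) ys) \<le> lf"
  proof (rule norm_gradient_le[OF _ lf])
    show "GDERIV (\<lambda>v. f (x, v)) ys :> grad (\<lambda>v. f (x, v)) ys"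
      using sf by (simp add: has_lipschitz_gradient_def)
    show "f (x, ys) - lf * norm (u - ys) \<le> f (x, u)" for u
      using low[of "(x, ys)" "(x, u)"] by (simp add: norm_Pair)
  qed
  moreover have "\<sigma> *\<^sub>R grad (\<lambda>v. f (x, v)) ys + grad ?g ys = 0"
    using s.grad_minimizer[OF ys(1)] grad_cmult_add[OF sf sg] by simp
  then have "norm (grad ?g ys) = \<sigma> * norm (grad (\<lambda>v. f (x, v)) ys)"
    using \<sigma> by (metis abs_of_pos add.commute add_eq_0_iff norm_minus_cancel norm_scaleR)
  ultimately have "norm (grad ?g ys) \<le> \<sigma> * lf"
    using \<sigma> by simp
  then have d2: "norm (ys - ps) \<le> \<sigma> * lf / \<mu>"
    using mu by (intro order_trans[OF ps(2)] divide_right_mono) auto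
  have d1: "norm (y - ys) \<le> \<sigma>\<^sup>2 / \<mu>"
    using y mu by (intro order_trans[OF ys(2)] divide_right_mono) auto
  have "norm (z - zs) \<le> \<sigma>\<^sup>2 / \<mu>"
    using z mu by (intro order_trans[OF zs(2)] divide_right_mono) auto
  then have d3: "norm (zs - z) \<le> \<sigma>\<^sup>2 / \<mu>"
    by (simp add: norm_minus_commute)

  have "G ps = G zs"
    unfolding G_def by (rule grad_fst_minimizer_unique[OF g PLg mu_le ps(1) zs(1)])
  \<comment> \<open>The path runs from \<open>y\<close> over \<open>ys\<close> to \<open>ps\<close>
    and from \<open>zs\<close> to \<open>z\<close>; the jump from \<open>ps\<close> to
    \<open>zs\<close> is free. Every leg is of order \<open>\<sigma>\<close> or smaller, which
    cancels the factor \<open>1 / \<sigma>\<close> of the estimate.\<close>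
  then have "G y - G z = (G y - G ys) + (G ys - G ps) + (G zs - G z)"
    by simp
  also have "norm \<dots> \<le> norm (G y - G ys) + norm (G ys - G ps) + norm (G zs - G z)"
    by norm
  also have "\<dots> \<le> Lg * (\<sigma>\<^sup>2 / \<mu>) + Lg * (\<sigma> * lf / \<mu>) + Lg * (\<sigma>\<^sup>2 / \<mu>)"
    using d1 d2 d3 Lg by (intro add_mono order_trans[OF G] mult_left_mono)
  also have "\<dots> = \<sigma> * (Lg * lf / \<mu> + 2 * Lg * \<sigma> / \<mu>)"
    using mu by (simp add: power2_eq_square field_simps)
  finally have "norm ((1 / \<sigma>) *\<^sub>R (G y - G z)) \<le> Lg * lf / \<mu> + 2 * Lg * \<sigma> / \<mu>"
    using \<sigma> by (simp add: divide_le_eq mult.commute[of \<sigma>])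
  moreover have "norm (grad (\<lambda>u. f (u, y)) x) \<le> lf"
  proof (rule norm_gradient_le[OF _ lf])
    show "GDERIV (\<lambda>u. f (u, y)) x :> grad (\<lambda>u. f (u, y)) x"
      using smooth_slice_fst[OF f(2)] by (simp add: has_lipschitz_gradient_def)
    show "f (x, y) - lf * norm (u - x) \<le> f (u, y)" for u
      using low[of "(x, y)" "(u, y)"] by (simp add: norm_Pair)
  qed
  ultimately show ?thesis
    unfolding hypergrad_est_def G_def[symmetric] add.assoc by (intro norm_triangle_mono)
qed

section \<open>The optimality gap at a warm start\<close>

lemma warm_gap_eq:
  assumes "0 < \<mu>"
  shows "warm_gap \<mu> L a0 \<delta> H = (L / \<mu>) ^ 3 * ((\<delta>\<^sup>2 + L\<^sup>2 * (H / a0)\<^sup>2) / \<mu>)"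
  using assms by (simp add: warm_gap_def field_simps power2_eq_square power3_eq_cube power4_eq_xxxx)

text \<open>The two sides differ by the factor \<open>(L / \<mu>) ^ 3\<close>, which is at least
  1.\<close>

lemma warm_gap_ge:
  assumes "0 < \<mu>" "\<mu> \<le> L"
  shows "(\<delta>\<^sup>2 + L\<^sup>2 * (H / a0)\<^sup>2) / \<mu> \<le> warm_gap \<mu> L a0 \<delta> H"
proof -
  have "1 \<le> (L / \<mu>) ^ 3"
    using assms by (intro one_le_power) simp
  then show ?thesis
    unfolding warm_gap_eq[OF assms(1)] using assms(1)
      mult_right_mono[of 1 "(L / \<mu>) ^ 3" "(\<delta>\<^sup>2 + L\<^sup>2 * (H / a0)\<^sup>2) / \<mu>"] by simp
qed

text \<open>Supplies the second condition on \<open>W\<close> in \<open>acgm_iterations_le\<close>,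
  the one that covers very short runs.\<close>

lemma tolerance_le_warm_gap:
  assumes "0 < \<mu>" "\<mu> \<le> L"
  shows "\<delta>\<^sup>2 \<le> L * warm_gap \<mu> L a0 \<delta> H"
proof -
  have "\<delta>\<^sup>2 = \<mu> * (\<delta>\<^sup>2 / \<mu>)"
    using assms by simp
  also have "\<dots> \<le> L * ((\<delta>\<^sup>2 + L\<^sup>2 * (H / a0)\<^sup>2) / \<mu>)"
    using assms by (intro mult_mono divide_right_mono) auto
  also have "\<dots> \<le> L * warm_gap \<mu> L a0 \<delta> H"
    using assms by (intro mult_left_mono warm_gap_ge) auto
  finally show ?thesis .
qed

lemma C_bar_eq: "C_bar \<mu> \<alpha> L0 L a0 \<delta> H = 2 * L * const_C \<mu> \<alpha> L0 L * warm_gap \<mu> L a0 \<delta> H"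
  by (simp add: C_bar_def warm_gap_def power2_eq_square)

text \<open>The squared sum of tolerance and gradient drift is at most twice the sum of squares, and
  this 2 cancels against the PL factor \<open>2 * \<mu>\<close>.\<close>

lemma gap_warm_start_le:
  fixes F :: "'a::real_inner \<times> 'b::real_inner \<Rightarrow> real"
  assumes F: "has_lipschitz_gradient L F" and PL: "PL \<mu> (\<lambda>v. F (x', v))"
    and mu: "0 < \<mu>" "\<mu> \<le> L"
    and v: "norm (grad (\<lambda>v. F (x, v)) v) \<le> \<delta>" and step: "norm (x' - x) \<le> H / a0"
  shows "gap (\<lambda>v. F (x', v)) v \<le> warm_gap \<mu> L a0 \<delta> H"
proof -
  let ?G = "grad (\<lambda>v. F (x', v)) v" and ?d = "L * (H / a0)"
  interpret smooth_PL "\<lambda>v. F (x', v)" \<mu> L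
    using PL smooth_slice_snd[OF F] mu by unfold_locales
  have "norm (?G - grad (\<lambda>v. F (x, v)) v) \<le> L * norm (x' - x)"
    using norm_grad_slice_snd_diff[OF F, of x' v x v] by (simp add: norm_Pair)
  also have "\<dots> \<le> ?d"
    using step L_pos by (intro mult_left_mono) auto
  finally have "norm ?G \<le> \<delta> + ?d"
    using v norm_triangle_sub[of ?G "grad (\<lambda>v. F (x, v)) v"] by linarith
  then have "(norm ?G)\<^sup>2 \<le> (\<delta> + ?d)\<^sup>2"
    by (rule power_mono) simp
  also have "\<dots> \<le> 2 * (\<delta>\<^sup>2 + ?d\<^sup>2)"
    using zero_le_power2[of "\<delta> - ?d"] by (simp only: power2_sum power2_diff) simp
  finally have "2 * \<mu> * gap (\<lambda>v. F (x', v)) v \<le> 2 * (\<delta>\<^sup>2 + ?d\<^sup>2)"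
    using PL_gap[of v] by simp
  then have "gap (\<lambda>v. F (x', v)) v \<le> (\<delta>\<^sup>2 + ?d\<^sup>2) / \<mu>"
    using mu(1) by (simp add: field_simps)
  also have "\<dots> \<le> warm_gap \<mu> L a0 \<delta> H"
    unfolding power_mult_distrib by (rule warm_gap_ge[OF mu])
  finally show ?thesis .
qed

theorem proposition3p2:
  fixes f g :: "(real ^ 'm) \<times> (real ^ 'n) \<Rightarrow> real"
    and \<mu> \<sigma>bar lf Lf Lg \<rho>f \<rho>g C\<sigma> :: real
    and x0 :: "real ^ 'm" and y0 z0 :: "real ^ 'n"
    and a0 \<alpha> L01 L02 \<epsilon> :: real
    and x :: "nat \<Rightarrow> real ^ 'm" and a :: "nat \<Rightarrow> real" and y z :: "nat \<Rightarrow> real ^ 'n"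
    and K N :: "nat \<Rightarrow> nat" and T :: nat
  defines "L\<sigma> \<equiv> Lf + Lg"
    and "C\<phi> \<equiv> C_phi \<mu> lf Lf Lg C\<sigma>"
    and "pg \<equiv> rate_p \<mu> \<alpha> L01 Lg"
    and "p\<sigma> \<equiv> rate_p \<mu> \<alpha> L02 (Lf + Lg)"
    and "Cb \<equiv> C_bar \<mu> \<alpha> L01 Lg a0 (\<epsilon>\<^sup>2) (C_phi \<mu> lf Lf Lg C\<sigma>)"
    and "Cc \<equiv> C_bar \<mu> \<alpha> L02 (Lf + Lg) a0 (\<epsilon>\<^sup>2) (C_phi \<mu> lf Lf Lg C\<sigma>)"
  assumes pos: "\<mu> > 0" "\<sigma>bar > 0" "lf > 0" "Lf > 0" "Lg > 0" "\<rho>f > 0" "\<rho>g > 0"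
    and mu_le: "\<mu> \<le> Lg"
    and A1: "\<And>\<sigma> u. 0 \<le> \<sigma> \<Longrightarrow> \<sigma> \<le> \<sigma>bar \<Longrightarrow> PL \<mu> (\<lambda>v. \<sigma> * f (u, v) + g (u, v))"
    and A2: "lf-lipschitz_on UNIV f" "has_lipschitz_gradient Lf f"
    and A3: "has_lipschitz_gradient Lg g"
    and A4: "has_lipschitz_hessian \<rho>f f"
    and A5: "has_lipschitz_hessian \<rho>g g"
    and phi_min: "\<And>u. attains_min_on (\<lambda>v. f (u, v)) (lower_sol g u)"
    and Csigma: "\<And>\<sigma> u. 0 < \<sigma> \<Longrightarrow> \<sigma> \<le> min (\<rho>g / \<rho>f) \<sigma>bar \<Longrightarrow>
                   norm (grad (penalty_obj f g \<sigma>) u - grad (hyper_obj f g) u) \<le> C\<sigma> * \<sigma>"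
    and inputs: "a0 > 0" "\<alpha> > 1" "L01 > 0" "L02 > 0" "\<epsilon> > 0"
    and eps_le: "\<epsilon> \<le> Min {\<rho>g / \<rho>f, \<sigma>bar, 1}"
    and T: "T = nat \<lceil>1 / \<epsilon>\<^sup>2\<rceil>"
    and run: "a2f2ba_run f g x0 y0 z0 a0 \<alpha> L01 L02 \<epsilon> T x a y z K N"
  shows "0 < pg \<and> pg < 1 \<and> 0 < p\<sigma> \<and> p\<sigma> < 1 \<and>
    (\<forall>t<T.
       acgm_terminates (\<lambda>v. g (x t, v)) (warm_start z0 z t) \<alpha> L01 (\<epsilon>\<^sup>2) \<and>
       acgm_terminates (\<lambda>v. \<epsilon> * f (x t, v) + g (x t, v)) (warm_start y0 y t) \<alpha> L02 (\<epsilon>\<^sup>2) \<and>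
       ((t = 0 \<longrightarrow> g (x0, z0) - lower_val g x0 \<le> warm_gap \<mu> Lg a0 (\<epsilon>\<^sup>2) C\<phi>) \<longrightarrow>
          real (K t) \<le> ln (Cb / (\<epsilon>\<^sup>2)\<^sup>2) / ln (1 / (1 - pg))) \<and>
       ((t = 0 \<longrightarrow> (\<epsilon> * f (x0, y0) + g (x0, y0)) - (INF v. \<epsilon> * f (x0, v) + g (x0, v))
                     \<le> warm_gap \<mu> L\<sigma> a0 (\<epsilon>\<^sup>2) C\<phi>) \<longrightarrow>
          real (N t) \<le> ln (Cc / (\<epsilon>\<^sup>2)\<^sup>2) / ln (1 / (1 - p\<sigma>))))"
proof -
  let ?F = "\<lambda>p. \<epsilon> * f p + g p"
  let ?C = "C_phi \<mu> lf Lf Lg C\<sigma>"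
  have eps: "0 < \<epsilon>" "\<epsilon> \<le> 1" "\<epsilon> \<le> \<sigma>bar" "\<epsilon> \<le> \<rho>g / \<rho>f"
    using inputs eps_le by auto
  have PLg: "PL \<mu> (\<lambda>v. g (u, v))" for u
    using A1[of 0 u] pos by simp
  have PLF: "PL \<mu> (\<lambda>v. ?F (u, v))" for u
    using A1[of \<epsilon> u] eps by simp
  have smooth_F: "has_lipschitz_gradient (Lf + Lg) ?F"
    using A2(2) A3 eps by (intro smooth_cmult_add) auto
  have mu_le': "\<mu> \<le> Lf + Lg"
    using mu_le pos by simp
  have solver_g: "acgm_PL (\<lambda>v. g (u, v)) \<mu> Lg \<alpha> L01" for u
    using PLg smooth_slice_snd[OF A3] mu_le inputs by unfold_locales auto
  have solver_F: "acgm_PL (\<lambda>v. ?F (u, v)) \<mu> (Lf + Lg) \<alpha> L02" for u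
    using PLF smooth_slice_snd[OF smooth_F] mu_le' inputs by unfold_locales auto

  have x0: "x 0 = x0" and a0: "a 0 = a0"
    using run by (auto simp: a2f2ba_run_def)
  have acgm_z: "(z t, K t) = acgm (\<lambda>v. g (x t, v)) (warm_start z0 z t) \<alpha> L01 (\<epsilon>\<^sup>2)"
    and acgm_y: "(y t, N t) = acgm (\<lambda>v. ?F (x t, v)) (warm_start y0 y t) \<alpha> L02 (\<epsilon>\<^sup>2)"
    and a_Suc: "a (Suc t) = sqrt ((a t)\<^sup>2 + (norm (hypergrad_est f g \<epsilon> (x t) (y t) (z t)))\<^sup>2)"
    and x_Suc: "x (Suc t) = x t - (1 / a (Suc t)) *\<^sub>R hypergrad_est f g \<epsilon> (x t) (y t) (z t)"
    if "t < T" for t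
    using run that unfolding a2f2ba_run_def by blast+
  have grad_z: "norm (grad (\<lambda>v. g (x t, v)) (z t)) \<le> \<epsilon>\<^sup>2"
    and grad_y: "norm (grad (\<lambda>v. ?F (x t, v)) (y t)) \<le> \<epsilon>\<^sup>2" if "t < T" for t
    using acgm_PL.norm_grad_acgm_le[OF solver_g _ acgm_z[OF that]]
      acgm_PL.norm_grad_acgm_le[OF solver_F _ acgm_y[OF that]] eps(1) by simp_all

  \<comment> \<open>The adaptive denominators never drop below \<open>a0\<close>, so the outer step
    is bounded uniformly in \<open>t\<close>.\<close>
  have a_ge: "t \<le> T \<Longrightarrow> a0 \<le> a t" for t
  proof (induction t)
    case (Suc t)
    then have "a t \<le> a (Suc t)"
      using a_Suc[of t] by (simp add: real_le_rsqrt)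
    then show ?case
      using Suc by simp
  qed (simp add: a0)
  \<comment> \<open>The assumed bound on a norm at \<open>\<sigma> = \<epsilon>\<close> forces the
    sign of \<open>C\<sigma>\<close>, which lets \<open>C_phi\<close> dominate the bound on the
    estimate.\<close>
  have "0 \<le> C\<sigma> * \<epsilon>"
    using Csigma[of \<epsilon> x0] eps by (meson min.boundedI norm_ge_zero order_trans)
  then have Csigma_nonneg: "0 \<le> C\<sigma>"
    using eps(1) by (simp add: zero_le_mult_iff)
  have step: "norm (x (Suc t) - x t) \<le> ?C / a0" if t: "t < T" for t
  proof -
    let ?H = "hypergrad_est f g \<epsilon> (x t) (y t) (z t)"
    have "norm ?H \<le> lf + Lg * lf / \<mu> + 2 * Lg * \<epsilon> / \<mu>"
      using A2 A3 mu_le PLg PLF eps grad_z[OF t] grad_y[OF t] by (intro norm_hypergrad_est_le) auto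
    also have "\<dots> \<le> lf + Lg * lf / \<mu> + 2 * Lg * 1 / \<mu>"
      using eps pos by (intro add_left_mono divide_right_mono mult_left_mono) auto
    also have "\<dots> \<le> ?C"
      using pos Csigma_nonneg by (simp add: C_phi_def)
    finally have H: "norm ?H \<le> ?C" .
    have "a0 \<le> a (Suc t)"
      using a_ge[of "Suc t"] t by simp
    then have "norm ?H / a (Suc t) \<le> ?C / a0"
      using H inputs(1) by (intro frac_le order_trans[OF norm_ge_zero H]) auto
    then show ?thesis
      using x_Suc[OF t] \<open>a0 \<le> a (Suc t)\<close> inputs(1) by simp
  qed

  have gap_g: "gap (\<lambda>v. g (x t, v)) (warm_start z0 z t) \<le> warm_gap \<mu> Lg a0 (\<epsilon>\<^sup>2) ?C"
    if "t < T" "t = 0 \<longrightarrow> g (x0, z0) - lower_val g x0 \<le> warm_gap \<mu> Lg a0 (\<epsilon>\<^sup>2) C\<phi>" for t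
  proof (cases t)
    case 0
    then show ?thesis
      using that(2) by (simp add: x0 warm_start_def gap_def lower_val_def C\<phi>_def)
  next
    case (Suc s)
    then show ?thesis
      using gap_warm_start_le[OF A3 PLg pos(1) mu_le grad_z[of s] step[of s]] that(1)
      by (simp add: warm_start_def)
  qed
  have gap_F: "gap (\<lambda>v. ?F (x t, v)) (warm_start y0 y t) \<le> warm_gap \<mu> (Lf + Lg) a0 (\<epsilon>\<^sup>2) ?C"
    if "t < T" "t = 0 \<longrightarrow> (\<epsilon> * f (x0, y0) + g (x0, y0)) - (INF v. \<epsilon> * f (x0, v) + g (x0, v))
      \<le> warm_gap \<mu> L\<sigma> a0 (\<epsilon>\<^sup>2) C\<phi>" for t
  proof (cases t)
    case 0
    then show ?thesis
      using that(2) by (simp add: x0 warm_start_def gap_def C\<phi>_def L\<sigma>_def)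
  next
    case (Suc s)
    then show ?thesis
      using gap_warm_start_le[OF smooth_F PLF pos(1) mu_le' grad_y[of s] step[of s]] that(1)
      by (simp add: warm_start_def)
  qed

  have "0 < \<epsilon>\<^sup>2"
    using eps(1) by simp
  \<comment> \<open>With \<open>W\<close> the warm gap, the numerator \<open>2 * L * C * W\<close>
    is exactly \<open>C_bar\<close>, so folding yields the constants of the claim.\<close>
  note iterations_g = acgm_PL.acgm_iterations_le[OF solver_g this acgm_z gap_g
      tolerance_le_warm_gap[OF pos(1) mu_le], folded C_bar_eq pg_def Cb_def]
    and iterations_F = acgm_PL.acgm_iterations_le[OF solver_F this acgm_y gap_F
      tolerance_le_warm_gap[OF pos(1) mu_le'], folded C_bar_eq p\<sigma>_def Cc_def]
  have "0 < pg" "pg < 1" "0 < p\<sigma>" "p\<sigma> < 1"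
    using rate_p_bounds[OF pos(1) mu_le inputs(2,3)] rate_p_bounds[OF pos(1) mu_le' inputs(2,4)]
    by (simp_all add: pg_def p\<sigma>_def)
  then show ?thesis
    using iterations_g iterations_F acgm_PL.terminates[OF solver_g \<open>0 < \<epsilon>\<^sup>2\<close>]
      acgm_PL.terminates[OF solver_F \<open>0 < \<epsilon>\<^sup>2\<close>]
    by blast
qed

end
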